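(* Let $q \ge 2$, let $r \ge 1$, and let $(\Omega,\mu)$ be a finite probability space. Let $f\colon (\Omega^n,\mu^n)\to\mathbb{R}$ satisfy $\|f_{S\to x}\|_2 \le r^{|S|}\|f\|_2$ for all $S\subseteq[n]$ and all $x\in\Omega^S$. If $0<\rho \le \frac{\log q}{32 r q}$, then $\|T_\rho f\|_q \le \|f\|_2$.
   Context: $\log$ denotes the natural logarithm. All norms are with respect to the product measure $\mu^n$ (or its projection on the relevant coordinates). For $S\subseteq[n]$ and $x\in\Omega^S$, the restriction $f_{S\to x}\colon\Omega^{[n]\setminus S}\to\mathbb{R}$ is $f_{S\to x}(y)=f(x,y)$. The noise operator $T_\rho$ is $T_\rho f(x)=\mathbb{E}_{y}[f(y)]$, where $y$ is obtained from $x$ by keeping each coordinate $x_i$ independently with probability $\rho$ and replacing it by an independent sample of $\mu$ with probability $1-\rho$. *)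

theory Defs
  imports "HOL-Analysis.Analysis"
begin

text \<open>Finite probability space: a finite type 'a with probability weights mu.
  Points of Omega^S are extensional functions in PiE S (\<lambda>_. UNIV).
  [n] is rendered as {..<n}.\<close>

definition fin_prob :: "('a::finite \<Rightarrow> real) \<Rightarrow> bool" where
  "fin_prob mu \<longleftrightarrow> (\<forall>w. 0 \<le> mu w) \<and> (\<Sum>w\<in>UNIV. mu w) = 1"

definition pts :: "nat set \<Rightarrow> (nat \<Rightarrow> 'a::finite) set" where
  "pts S = PiE S (\<lambda>_. UNIV)"

definition expect :: "('a::finite \<Rightarrow> real) \<Rightarrow> nat set \<Rightarrow> ((nat \<Rightarrow> 'a) \<Rightarrow> real) \<Rightarrow> real" where
  "expect mu S g = (\<Sum>x\<in>pts S. (\<Prod>i\<in>S. mu (x i)) * g x)"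

definition merge :: "nat set \<Rightarrow> (nat \<Rightarrow> 'a) \<Rightarrow> (nat \<Rightarrow> 'a) \<Rightarrow> (nat \<Rightarrow> 'a)" where
  "merge S x y = (\<lambda>i. if i \<in> S then x i else y i)"

definition lnorm :: "('a::finite \<Rightarrow> real) \<Rightarrow> nat set \<Rightarrow> real \<Rightarrow> ((nat \<Rightarrow> 'a) \<Rightarrow> real) \<Rightarrow> real" where
  "lnorm mu S p g = (expect mu S (\<lambda>x. \<bar>g x\<bar> powr p)) powr (1 / p)"

definition restr :: "nat set \<Rightarrow> ((nat \<Rightarrow> 'a) \<Rightarrow> real) \<Rightarrow> (nat \<Rightarrow> 'a) \<Rightarrow> (nat \<Rightarrow> 'a) \<Rightarrow> real" where
  "restr S f x = (\<lambda>y. f (merge S x y))"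

text \<open>Noise operator on Omega^n: the set K of kept coordinates is chosen with
  each coordinate kept independently with probability rho; the other coordinates
  are resampled from mu.\<close>
definition noise :: "('a::finite \<Rightarrow> real) \<Rightarrow> nat \<Rightarrow> real \<Rightarrow> ((nat \<Rightarrow> 'a) \<Rightarrow> real) \<Rightarrow> (nat \<Rightarrow> 'a) \<Rightarrow> real" where
  "noise mu n rho f x = (\<Sum>K\<in>Pow {..<n}. rho ^ card K * (1 - rho) ^ (n - card K) *
      expect mu ({..<n} - K) (\<lambda>y. f (merge K x y)))"

end

theory Submission
  imports Defs
begin

text \<open>
  Idea: for a function of one coordinate with values in a Hilbert space, split into mean \<open>a\<close> and
  mean-zero part \<open>Z\<close>. A Taylor expansion for small \<open>Z\<close>, and brute force for large \<open>Z\<close>, give the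
  Rosenthal-type inequality
  \<open>E |a + \<rho> Z|^q \<le> (|a|^2 + 3/4 E |Z|^2)^(q/2) + (2r)^(-q) E |Z|^q\<close>,
  where \<open>|a|^2 + 3/4 E |Z|^2\<close> is the second moment of \<open>a + sqrt (3/4) Z\<close>.
  Apply it coordinate by coordinate: a coordinate \<open>i\<close> either moves from the \<open>L^q\<close> to the
  \<open>L^2\<close> side at the cost of replacing \<open>f\<close> by \<open>T_sqrt(3/4) f\<close> in direction \<open>i\<close>, or \<open>f\<close> is
  replaced by its Laplacian \<open>L_i f\<close> and \<open>x_i\<close> is frozen. The Laplacian satisfies the globalness
  hypothesis with \<open>M\<close> replaced by \<open>2rM\<close>; the resulting loss \<open>(2r)^(q-2)\<close> is beaten by
  \<open>(2r)^(-q) \<le> (2r)^(2-q) / 4\<close>, and \<open>3/4 + 1/4 = 1\<close> closes the induction.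
\<close>

section \<open>Scalar inequalities behind the one-coordinate estimate\<close>

text \<open>Multiplying \<open>1 - x \<le> exp (- x)\<close> by \<open>exp x\<close> bounds the
  Taylor remainder by \<open>x * (exp x - 1)\<close>; what is left is a first-order estimate of
  \<open>exp x - 1\<close>, by the sign of \<open>x\<close>.\<close>

lemma exp_le_quadratic:
  fixes x :: real
  shows "exp x \<le> 1 + x + x\<^sup>2 * exp \<bar>x\<bar>"
proof -
  have tangent: "1 - x \<le> exp (- x)"
    using exp_ge_add_one_self[of "- x"] by simp
  have "exp x * (1 - x) \<le> exp x * exp (- x)"
    by (rule mult_left_mono[OF tangent]) simp
  then have *: "exp x - 1 - x \<le> x * (exp x - 1)"
    by (simp add: exp_minus algebra_simps)
  have "x * (exp x - 1) \<le> x\<^sup>2 * exp \<bar>x\<bar>"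
  proof (cases "x \<ge> 0")
    case True
    have "exp x - 1 \<le> x * exp x"
      using * by (simp add: algebra_simps)
    then have "x * (exp x - 1) \<le> x * (x * exp x)"
      by (rule mult_left_mono) (use True in simp)
    then show ?thesis using True by (simp add: power2_eq_square algebra_simps)
  next
    case False
    have "- x * (1 - exp x) \<le> - x * (- x)"
      by (rule mult_left_mono) (use False exp_ge_add_one_self[of x] in \<open>simp_all add: algebra_simps\<close>)
    also have "\<dots> \<le> x\<^sup>2 * exp \<bar>x\<bar>"
      using mult_left_mono[of 1 "exp \<bar>x\<bar>" "x\<^sup>2"] by (simp add: power2_eq_square)
    finally show ?thesis by (simp add: algebra_simps)
  qed
  with * show ?thesis by linarith
qed

text \<open>Apply \<open>ln y \<le> y - 1\<close> to the fourth root of \<open>q\<close>. The bound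
  later lets powers of \<open>q\<close> absorb the logarithm in the hypothesis on rho.\<close>

lemma ln_squared_le_sqrt:
  fixes q :: real
  assumes "q \<ge> 1"
  shows "(ln q)\<^sup>2 \<le> 16 * sqrt q"
proof -
  have q: "sqrt (sqrt q) > 0" using assms by simp
  have "q = (sqrt (sqrt q)) ^ 4"
    using assms by (simp add: power4_eq_xxxx flip: power2_eq_square)
      (metis mult.assoc power2_eq_square abs_of_nonneg order_trans real_sqrt_abs real_sqrt_ge_zero real_sqrt_pow2 zero_le_one)
  then have "ln q = 4 * ln (sqrt (sqrt q))"
    using ln_realpow[of "sqrt (sqrt q)" 4] by simp
  also have "\<dots> \<le> 4 * sqrt (sqrt q)"
    using ln_le_minus_one[OF q] by simp
  finally have "(ln q)\<^sup>2 \<le> (4 * sqrt (sqrt q))\<^sup>2"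
    by (rule power_mono) (use assms in simp)
  then show ?thesis using assms by (simp add: power_mult_distrib)
qed

text \<open>The Rosenthal-type bound before averaging, normalised to \<open>|a| = 1\<close>:
  \<open>s\<close> is the norm of rho Z and \<open>u\<close> its inner product with
  \<open>a\<close>. Later \<open>A = 1/rho\<close> and \<open>B = 1/(2 r rho)\<close>. With
  \<open>t = q / ln q\<close>, the split is at \<open>15 t s = 1\<close>: above it the last term
  dominates, below it a second-order expansion works.\<close>

lemma powr_one_plus_bound:
  fixes q A B s u :: real
  assumes q: "q \<ge> 2" and s: "s \<ge> 0" and u: "\<bar>u\<bar> \<le> s"
    and A: "A \<ge> 32 * (q / ln q)" and B: "B \<ge> 16 * (q / ln q)"
  shows "(1 + 2 * u + s\<^sup>2) powr (q / 2) \<le> 1 + q * u + q / 2 * (3 / 4 * A\<^sup>2 * s\<^sup>2) + (B * s) powr q"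
proof -
  define L where "L = ln q"
  define t where "t = q / L"
  have L: "L > 0" using q unfolding L_def by simp
  have "L \<le> q" using ln_le_minus_one[of q] q by (simp add: L_def)
  then have t: "t \<ge> 1" unfolding t_def using L by simp
  have "(32 * t)\<^sup>2 \<le> A\<^sup>2" by (rule power_mono) (use A t in \<open>auto simp: t_def L_def\<close>)
  then have "q / 2 * (3 / 4 * (32 * t)\<^sup>2 * s\<^sup>2) \<le> q / 2 * (3 / 4 * A\<^sup>2 * s\<^sup>2)"
    by (intro mult_left_mono mult_right_mono) (use q in auto)
  \<comment> \<open>The constant is 384 = 1/2 * 3/4 * 32^2; this is the whole budget for
    second-order errors.\<close>
  then have A': "384 * q * t\<^sup>2 * s\<^sup>2 \<le> q / 2 * (3 / 4 * A\<^sup>2 * s\<^sup>2)"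
    by (simp add: power_mult_distrib)
  have B0: "(16 * t * s) powr q \<le> (B * s) powr q"
  proof (rule powr_mono2)
    show "16 * t * s \<le> B * s" by (rule mult_right_mono) (use B s in \<open>auto simp: t_def L_def\<close>)
  qed (use q t s in auto)
  have base: "0 \<le> 1 + 2 * u + s\<^sup>2"
    using u zero_le_power2[of "1 - s"] by (simp add: power2_eq_square algebra_simps)
  show ?thesis
  proof (cases "15 * t * s \<ge> 1")
    case True
    have "1 + s \<le> 16 * t * s"
      using True mult_right_mono[OF t s] by linarith
    moreover have "(1 + 2 * u + s\<^sup>2) powr (q / 2) \<le> ((1 + s)\<^sup>2) powr (q / 2)"
      by (rule powr_mono2) (use q base u in \<open>auto simp: power2_eq_square algebra_simps\<close>)
    moreover have "((1 + s)\<^sup>2) powr (q / 2) = (1 + s) powr q"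
      using s by (simp add: powr_powr flip: powr_numeral)
    moreover have "(1 + s) powr q \<le> (16 * t * s) powr q" if "1 + s \<le> 16 * t * s"
      by (rule powr_mono2) (use q s that in auto)
    ultimately have 1: "(1 + 2 * u + s\<^sup>2) powr (q / 2) \<le> (B * s) powr q"
      using B0 by linarith
    \<comment> \<open>The linear term \<open>q * u\<close> can be as low as \<open>- q * s\<close>;
      the quadratic term compensates for it.\<close>
    have "q * s * 1 \<le> q * s * (384 * (t * (t * s)))"
    proof (rule mult_left_mono)
      have "1 * (t * s) \<le> t * (t * s)" using t s by (intro mult_right_mono) auto
      then show "1 \<le> 384 * (t * (t * s))" using True by simp
    qed (use q s in auto)
    then have "q * s \<le> 384 * q * t\<^sup>2 * s\<^sup>2" by (simp add: power2_eq_square algebra_simps)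
    moreover have "q * (- s) \<le> q * u" using u q by (intro mult_left_mono) auto
    ultimately show ?thesis using 1 A' by linarith
  next
    case False
    define w where "w = q / 2 * (2 * u + s\<^sup>2)"
    have "1 * s \<le> t * s" by (rule mult_right_mono[OF t s])
    with False have s15: "s \<le> 1 / 15" by simp
    have "q * s = L * (t * s)" using L by (simp add: t_def)
    also have "\<dots> \<le> L * (1 / 15)" by (rule mult_left_mono) (use False L in auto)
    finally have qs: "q * s \<le> L / 15" by simp
    have "\<bar>2 * u + s\<^sup>2\<bar> \<le> 2 * s + s * (1 / 15)"
      using u mult_left_mono[OF s15 s] zero_le_power2[of s] unfolding power2_eq_square by linarith
    then have "q / 2 * \<bar>2 * u + s\<^sup>2\<bar> \<le> q / 2 * (2 * s + s * (1 / 15))"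
      by (rule mult_left_mono) (use q in auto)
    then have w: "\<bar>w\<bar> \<le> 31 / 30 * (q * s)"
      using q by (simp add: w_def abs_mult)
    \<comment> \<open>Here \<open>|w|\<close> is at most \<open>31/450 * ln q\<close>, well below
      \<open>ln q / 2\<close>.\<close>
    have "\<bar>w\<bar> \<le> ln (sqrt q)" using w qs q L by (simp add: L_def ln_sqrt)
    then have "exp \<bar>w\<bar> \<le> exp (ln (sqrt q))" by simp
    then have ew: "exp \<bar>w\<bar> \<le> sqrt q" using q by simp
    have "w\<^sup>2 \<le> (31 / 30 * (q * s))\<^sup>2"
      using power_mono[OF w, of 2] by simp
    also have "\<dots> \<le> 2 * (q * s)\<^sup>2" by (simp add: power_mult_distrib power_divide)
    finally have w2: "w\<^sup>2 * exp \<bar>w\<bar> \<le> 2 * (q * s)\<^sup>2 * sqrt q"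
      by (rule mult_mono[OF _ ew]) auto
    have sq: "1 \<le> sqrt q" using q by simp
    have sqq: "sqrt q * sqrt q = q" using q by simp
    \<comment> \<open>The coefficient of \<open>s^2\<close> in the error must stay below
      \<open>384 q t^2 = 384 q^3 / L^2\<close>. Trading \<open>L^2\<close> for
      \<open>16 * sqrt q\<close> makes this a comparison of powers of \<open>q\<close>.\<close>
    have "(q / 2 + 2 * q\<^sup>2 * sqrt q) * L\<^sup>2 \<le> (q / 2 + 2 * q\<^sup>2 * sqrt q) * (16 * sqrt q)"
      using ln_squared_le_sqrt[of q] q by (intro mult_left_mono) (auto simp: L_def)
    also have "\<dots> = 8 * (q * sqrt q) + 32 * q\<^sup>2 * (sqrt q * sqrt q)" by (simp add: algebra_simps)
    also have "\<dots> \<le> 8 * (q * q) + 32 * q\<^sup>2 * q"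
    proof -
      have "sqrt q * 1 \<le> sqrt q * sqrt q" by (rule mult_left_mono) (use sq in auto)
      then have "sqrt q \<le> q" using sqq by simp
      then show ?thesis using q sqq by simp
    qed
    also have "\<dots> \<le> 384 * q ^ 3"
    proof -
      have "q * q * 1 \<le> q * q * q" by (rule mult_left_mono) (use q in auto)
      then show ?thesis using q by (simp add: power2_eq_square power3_eq_cube)
    qed
    finally have "q / 2 + 2 * q\<^sup>2 * sqrt q \<le> 384 * q ^ 3 / L\<^sup>2"
      using L by (simp add: pos_le_divide_eq)
    also have "\<dots> = 384 * q * t\<^sup>2" by (simp add: t_def power2_eq_square power3_eq_cube)
    finally have "(q / 2 + 2 * q\<^sup>2 * sqrt q) * s\<^sup>2 \<le> 384 * q * t\<^sup>2 * s\<^sup>2"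
      by (rule mult_right_mono) auto
    then have err: "q / 2 * s\<^sup>2 + 2 * (q * s)\<^sup>2 * sqrt q \<le> 384 * q * t\<^sup>2 * s\<^sup>2"
      by (simp add: algebra_simps)
    have "(1 + 2 * u + s\<^sup>2) powr (q / 2) \<le> exp (2 * u + s\<^sup>2) powr (q / 2)"
      by (rule powr_mono2) (use q base exp_ge_add_one_self[of "2 * u + s\<^sup>2"] in \<open>auto simp: add.assoc\<close>)
    also have "\<dots> = exp w" by (simp add: w_def powr_def mult.commute)
    also have "\<dots> \<le> 1 + w + w\<^sup>2 * exp \<bar>w\<bar>" by (rule exp_le_quadratic)
    also have "\<dots> \<le> 1 + (q * u + q / 2 * s\<^sup>2) + 2 * (q * s)\<^sup>2 * sqrt q"
      using w2 by (simp add: w_def algebra_simps)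
    also have "\<dots> \<le> 1 + q * u + q / 2 * (3 / 4 * A\<^sup>2 * s\<^sup>2)" using err A' by linarith
    finally show ?thesis using powr_ge_zero[of "B * s" q] by linarith
  qed
qed

text \<open>Homogeneous form, with \<alpha> = |a|^2, \<open>z = |Z|^2\<close>, \<open>u\<close>
  their inner product and Cauchy-Schwarz as hypothesis; dividing by \<alpha> reduces it to the
  normalised bound. The term linear in \<open>u\<close> is kept because it averages to zero.\<close>

lemma powr_sum_bound:
  fixes q r rho \<alpha> u z :: real
  assumes q: "q \<ge> 2" and r: "r \<ge> 1" and rho: "0 < rho" "rho \<le> ln q / (32 * r * q)"
    and \<alpha>: "\<alpha> \<ge> 0" and z: "z \<ge> 0" and u: "u\<^sup>2 \<le> \<alpha> * z"
  shows "(\<alpha> + 2 * rho * u + rho\<^sup>2 * z) powr (q / 2)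
    \<le> \<alpha> powr (q / 2) + q * rho * \<alpha> powr (q / 2 - 1) * u
      + q / 2 * \<alpha> powr (q / 2 - 1) * (3 / 4 * z) + (1 / (2 * r)) powr q * z powr (q / 2)"
proof -
  have L: "ln q > 0" using q by simp
  have "rho * (32 * r * q) \<le> ln q" using rho q r by (simp add: pos_le_divide_eq)
  \<comment> \<open>This is the hypothesis on \<open>rho\<close> rearranged; the condition on
    \<open>A\<close> then follows from \<open>r \<ge> 1\<close>.\<close>
  then have B: "16 * (q / ln q) \<le> 1 / (2 * r) / rho"
    using L r rho by (simp add: field_simps)
  have "32 * (q / ln q) \<le> r * (32 * (q / ln q))"
    using mult_right_mono[OF r, of "32 * (q / ln q)"] L q by simp
  also have "\<dots> \<le> 1 / rho" using B r rho by (simp add: field_simps)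
  finally have A: "32 * (q / ln q) \<le> 1 / rho" .
  show ?thesis
  proof (cases "\<alpha> = 0")
    \<comment> \<open>Now \<open>u = 0\<close>, and \<open>0 powr x = 0\<close> for every exponent
      (also at \<open>q = 2\<close>) removes all terms with \<alpha>. The claim reduces to
      \<open>rho \<le> 1 / (2 * r)\<close>.\<close>
    case True
    have "16 * (q / ln q) > 0" using q L by simp
    have "ln q \<le> q" using ln_le_minus_one[of q] q by simp
    then have "1 \<le> 16 * (q / ln q)" using L q by (simp add: field_simps)
    with B have "1 \<le> 1 / (2 * r) / rho" by (rule order_trans[rotated])
    then have "rho \<le> 1 / (2 * r)" using rho r by (simp add: pos_le_divide_eq mult.commute)
    then have "(rho\<^sup>2 * z) powr (q / 2) \<le> ((1 / (2 * r))\<^sup>2 * z) powr (q / 2)"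
      using rho q z by (intro powr_mono2 mult_right_mono power_mono) auto
    also have "\<dots> = (1 / (2 * r)) powr q * z powr (q / 2)"
      using r z by (simp add: powr_mult powr_powr flip: powr_numeral)
    finally show ?thesis using True u q by simp
  next
    case False
    with \<alpha> have \<alpha>: "\<alpha> > 0" by simp
    define s where "s = rho * sqrt (z / \<alpha>)"
    define v where "v = rho * u / \<alpha>"
    have s: "s \<ge> 0" using rho z \<alpha> by (simp add: s_def)
    have s2: "s\<^sup>2 = rho\<^sup>2 * z / \<alpha>" using z \<alpha> by (simp add: s_def power_mult_distrib)
    have "u\<^sup>2 / \<alpha>\<^sup>2 \<le> \<alpha> * z / \<alpha>\<^sup>2" using u by (rule divide_right_mono) simp
    then have "rho\<^sup>2 * (u\<^sup>2 / \<alpha>\<^sup>2) \<le> rho\<^sup>2 * (z / \<alpha>)"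
      using \<alpha> by (intro mult_left_mono) (auto simp: power2_eq_square)
    then have "v\<^sup>2 \<le> s\<^sup>2" unfolding s2 v_def by (simp add: power_mult_distrib power_divide)
    then have v: "\<bar>v\<bar> \<le> s" using s by (simp add: abs_le_square_iff[symmetric])
    have "\<alpha> + 2 * rho * u + rho\<^sup>2 * z = \<alpha> * (1 + 2 * v + s\<^sup>2)"
      using \<alpha> by (simp add: s2 v_def field_simps)
    moreover have "0 \<le> 1 + 2 * v + s\<^sup>2"
      using v zero_le_power2[of "1 - s"] by (simp add: power2_eq_square algebra_simps)
    ultimately have "(\<alpha> + 2 * rho * u + rho\<^sup>2 * z) powr (q / 2)
        = \<alpha> powr (q / 2) * (1 + 2 * v + s\<^sup>2) powr (q / 2)"
      using \<alpha> by (simp add: powr_mult)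
    also have "\<dots> \<le> \<alpha> powr (q / 2) * (1 + q * v + q / 2 * (3 / 4 * (1 / rho)\<^sup>2 * s\<^sup>2)
        + (1 / (2 * r) / rho * s) powr q)"
      by (rule mult_left_mono[OF powr_one_plus_bound[OF q s v A B]]) simp
    also have "\<dots> = \<alpha> powr (q / 2) + q * rho * (\<alpha> powr (q / 2) / \<alpha>) * u
        + q / 2 * (\<alpha> powr (q / 2) / \<alpha>) * (3 / 4 * z)
        + \<alpha> powr (q / 2) * (1 / (2 * r) / rho * s) powr q"
      using rho \<alpha> by (simp add: s2 v_def field_simps)
    also have "\<alpha> powr (q / 2) / \<alpha> = \<alpha> powr (q / 2 - 1)"
      using \<alpha> by (simp add: powr_diff)
    also have "1 / (2 * r) / rho * s = 1 / (2 * r) * sqrt (z / \<alpha>)" using rho by (simp add: s_def)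
    also have "(1 / (2 * r) * sqrt (z / \<alpha>)) powr q = (1 / (2 * r)) powr q * (z / \<alpha>) powr (q / 2)"
      using r z \<alpha> powr_mult[of "1 / (2 * r)" "sqrt (z / \<alpha>)" q] powr_powr[of "z / \<alpha>" "1 / 2" q]
      by (simp only: powr_half_sqrt) (simp add: powr_half_sqrt)
    also have "(z / \<alpha>) powr (q / 2) = z powr (q / 2) / \<alpha> powr (q / 2)"
      using z \<alpha> by (simp add: powr_divide)
    finally show ?thesis using \<alpha> by simp
  qed
qed

text \<open>Tangent line of a convex power, via Bernoulli's inequality: Young's inequality for
  \<open>(1 + y/\<alpha>)^p\<close> and 1 with weights \<open>1/p\<close> and
  \<open>1 - 1/p\<close>. It reassembles first-order terms into a single power.\<close>

lemma powr_add_ge: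
  fixes p \<alpha> y :: real
  assumes p: "p \<ge> 1" and \<alpha>: "\<alpha> \<ge> 0" and y: "y \<ge> 0"
  shows "\<alpha> powr p + p * \<alpha> powr (p - 1) * y \<le> (\<alpha> + y) powr p"
proof (cases "\<alpha> = 0")
  case True
  then show ?thesis using p y by simp
next
  case False
  with \<alpha> have \<alpha>: "\<alpha> > 0" by simp
  have "((1 + y / \<alpha>) powr p) powr (1 / p) * 1 powr (1 - 1 / p)
      \<le> 1 / p * (1 + y / \<alpha>) powr p + (1 - 1 / p) * 1"
    using p \<alpha> y by (intro Youngs_inequality_0) (auto simp: add_pos_nonneg field_simps)
  moreover have "((1 + y / \<alpha>) powr p) powr (1 / p) = 1 + y / \<alpha>"
    using p \<alpha> y by (simp add: powr_powr)
  ultimately have "1 + p * (y / \<alpha>) \<le> (1 + y / \<alpha>) powr p"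
    using p mult_left_mono[of "1 + y / \<alpha>" "1 / p * (1 + y / \<alpha>) powr p + (1 - 1 / p)" p]
    by (simp add: algebra_simps)
  then have "\<alpha> powr p * (1 + p * (y / \<alpha>)) \<le> \<alpha> powr p * (1 + y / \<alpha>) powr p"
    by (rule mult_left_mono) simp
  also have "\<dots> = (\<alpha> * (1 + y / \<alpha>)) powr p" using \<alpha> y by (simp add: powr_mult)
  also have "\<alpha> * (1 + y / \<alpha>) = \<alpha> + y" using \<alpha> by (simp add: field_simps)
  finally show ?thesis using \<alpha> by (simp add: powr_diff field_simps)
qed

section \<open>Averages, noise and Laplacian in single coordinates\<close>

locale finite_probability =
  fixes mu :: "'a::finite \<Rightarrow> real"
  assumes fin_prob: "fin_prob mu"
begin

lemma mu_nonneg: "0 \<le> mu w"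
  using fin_prob by (simp add: fin_prob_def)

lemma mu_sum: "(\<Sum>w\<in>UNIV. mu w) = 1"
  using fin_prob by (simp add: fin_prob_def)

text \<open>The result remains a function of a full point, constant in the coordinates of
  \<open>S\<close>, so averages over different sets compose without a change of domain.\<close>

definition avg :: "nat set \<Rightarrow> ((nat \<Rightarrow> 'a) \<Rightarrow> real) \<Rightarrow> (nat \<Rightarrow> 'a) \<Rightarrow> real" where
  "avg S g x = expect mu S (\<lambda>y. g (merge S y x))"

definition cavg :: "nat \<Rightarrow> ((nat \<Rightarrow> 'a) \<Rightarrow> real) \<Rightarrow> (nat \<Rightarrow> 'a) \<Rightarrow> real" where
  "cavg i g x = (\<Sum>w\<in>UNIV. mu w * g (x(i := w)))"

definition cnoise :: "real \<Rightarrow> nat \<Rightarrow> ((nat \<Rightarrow> 'a) \<Rightarrow> real) \<Rightarrow> (nat \<Rightarrow> 'a) \<Rightarrow> real" where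
  "cnoise s i g x = s * g x + (1 - s) * cavg i g x"

definition claplace :: "nat \<Rightarrow> ((nat \<Rightarrow> 'a) \<Rightarrow> real) \<Rightarrow> (nat \<Rightarrow> 'a) \<Rightarrow> real" where
  "claplace i g x = g x - cavg i g x"

definition noise_on :: "real \<Rightarrow> nat set \<Rightarrow> ((nat \<Rightarrow> 'a) \<Rightarrow> real) \<Rightarrow> (nat \<Rightarrow> 'a) \<Rightarrow> real" where
  "noise_on s B g x = (\<Sum>K\<in>Pow B. s ^ card K * (1 - s) ^ (card B - card K) * avg (B - K) g x)"

lemma avg_empty [simp]: "avg {} g = g"
  by (simp add: avg_def expect_def pts_def merge_def fun_eq_iff)

text \<open>Fubini: a point on \<open>insert i S\<close> is a point on \<open>S\<close> updated at
  \<open>i\<close>, and its weight factors accordingly.\<close>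

lemma avg_insert:
  assumes S: "finite S" "i \<notin> S"
  shows "avg (insert i S) g = avg S (cavg i g)"
proof
  fix x
  let ?h = "\<lambda>(w, y::nat \<Rightarrow> 'a). y(i := w)"
  have inj: "inj_on ?h (UNIV \<times> pts S)"
  \<comment> \<open>The update hides the value at \<open>i\<close>, but points of
    \<open>pts S\<close> are \<open>undefined\<close> there because \<open>i\<close> lies outside
    \<open>S\<close>.\<close>
  proof (rule inj_onI, clarsimp)
    fix w y w' y'
    assume y: "y \<in> pts S" "y' \<in> pts S" and eq: "y(i := w) = y'(i := w')"
    have "w = w'" using fun_cong[OF eq, of i] by simp
    moreover have "y j = y' j" for j
      using fun_cong[OF eq, of j] y S by (cases "j = i") (auto simp: pts_def PiE_def extensional_def)
    ultimately show "w = w' \<and> y = y'" by auto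
  qed
  have "avg (insert i S) g x = (\<Sum>z\<in>?h ` (UNIV \<times> pts S).
      (\<Prod>j\<in>insert i S. mu (z j)) * g (merge (insert i S) z x))"
    unfolding avg_def expect_def pts_def by (subst PiE_insert_eq) simp
  also have "\<dots> = (\<Sum>(w, y)\<in>UNIV \<times> pts S. mu w * ((\<Prod>j\<in>S. mu (y j)) * g ((merge S y x)(i := w))))"
  proof (subst sum.reindex[OF inj], rule sum.cong[OF refl], clarsimp)
    fix w y
    have "(\<Prod>j\<in>S. mu (if j = i then w else y j)) = (\<Prod>j\<in>S. mu (y j))"
      using S by (intro prod.cong) auto
    moreover have "merge (insert i S) (y(i := w)) x = (merge S y x)(i := w)"
      by (auto simp: merge_def fun_eq_iff)
    ultimately show "(\<Prod>j\<in>insert i S. mu (if j = i then w else y j)) * g (merge (insert i S) (y(i := w)) x)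
        = mu w * ((\<Prod>j\<in>S. mu (y j)) * g ((merge S y x)(i := w)))"
      using S by simp
  qed
  also have "\<dots> = (\<Sum>y\<in>pts S. \<Sum>w\<in>UNIV. mu w * ((\<Prod>j\<in>S. mu (y j)) * g ((merge S y x)(i := w))))"
    by (subst sum.cartesian_product[symmetric]) (rule sum.swap)
  also have "\<dots> = avg S (cavg i g) x"
    by (simp add: avg_def expect_def cavg_def sum_distrib_left mult.left_commute)
  finally show "avg (insert i S) g x = avg S (cavg i g) x" .
qed

lemma cavg_avg:
  assumes "i \<notin> S"
  shows "cavg i (avg S g) = avg S (cavg i g)"
proof
  fix x :: "nat \<Rightarrow> 'a"
  have "merge S y (x(i := w)) = (merge S y x)(i := w)" for y :: "nat \<Rightarrow> 'a" and w
    using assms by (auto simp: merge_def fun_eq_iff)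
  then show "cavg i (avg S g) x = avg S (cavg i g) x"
    unfolding cavg_def avg_def expect_def sum_distrib_left
    by (subst sum.swap) (simp add: mult.left_commute)
qed

lemma avg_insert': "finite S \<Longrightarrow> i \<notin> S \<Longrightarrow> avg (insert i S) g = cavg i (avg S g)"
  by (simp add: avg_insert cavg_avg)

lemma avg_mono:
  assumes "\<And>y. g y \<le> h y"
  shows "avg S g x \<le> avg S h x"
  unfolding avg_def expect_def
  by (intro sum_mono mult_left_mono prod_nonneg assms mu_nonneg)

lemma avg_nonneg: "(\<And>y. 0 \<le> g y) \<Longrightarrow> 0 \<le> avg S g x"
  unfolding avg_def expect_def
  by (intro sum_nonneg mult_nonneg_nonneg prod_nonneg) (auto intro: mu_nonneg)

lemma avg_add: "avg S (\<lambda>y. g y + h y) x = avg S g x + avg S h x"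
  by (simp add: avg_def expect_def algebra_simps sum.distrib)

lemma avg_cmult: "avg S (\<lambda>y. c * g y) x = c * avg S g x"
  by (simp add: avg_def expect_def sum_distrib_left mult.left_commute)

lemma cavg_mono: "(\<And>y. g y \<le> h y) \<Longrightarrow> cavg i g x \<le> cavg i h x"
  unfolding cavg_def by (intro sum_mono mult_left_mono mu_nonneg)

lemma cavg_add: "cavg i (\<lambda>y. g y + h y) x = cavg i g x + cavg i h x"
  by (simp add: cavg_def algebra_simps sum.distrib)

lemma cavg_diff: "cavg i (\<lambda>y. g y - h y) x = cavg i g x - cavg i h x"
  by (simp add: cavg_def algebra_simps sum_subtractf)

lemma cavg_cmult: "cavg i (\<lambda>y. c * g y) x = c * cavg i g x"
  by (simp add: cavg_def sum_distrib_left mult.left_commute)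

lemma cavg_upd: "cavg i g (x(i := w)) = cavg i g x"
  by (simp add: cavg_def)

lemma cavg_const: "cavg i (\<lambda>y. c) x = c"
  by (simp add: cavg_def mu_sum flip: sum_distrib_right)

lemma cavg_pull:
  assumes "\<And>y w. g (y(i := w)) = g y"
  shows "cavg i (\<lambda>y. g y * h y) x = g x * cavg i h x"
  by (simp add: cavg_def assms sum_distrib_left mult.left_commute)

lemma cavg_claplace: "cavg i (claplace i g) x = 0"
proof -
  have "cavg i (cavg i g) x = cavg i g x"
    using cavg_pull[of "cavg i g" i "\<lambda>_. 1" x] by (simp add: cavg_upd cavg_const)
  then show ?thesis
    using cavg_diff[of i g "cavg i g" x] by (simp add: claplace_def[abs_def])
qed

lemma cnoise_eq: "cnoise s i g x = cavg i g x + s * claplace i g x"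
  by (simp add: cnoise_def claplace_def algebra_simps)

text \<open>Pythagoras: \<open>cavg i g\<close> is constant in coordinate \<open>i\<close> and the
  Laplacian has mean zero there, so the cross term vanishes.\<close>

lemma cavg_cnoise_square:
  "cavg i (\<lambda>y. (cnoise s i g y)\<^sup>2) x = (cavg i g x)\<^sup>2 + s\<^sup>2 * cavg i (\<lambda>y. (claplace i g y)\<^sup>2) x"
proof -
  have "(cnoise s i g y)\<^sup>2 = cavg i g y * cavg i g y
      + (2 * s * (cavg i g y * claplace i g y) + s\<^sup>2 * (claplace i g y)\<^sup>2)" for y
    by (simp add: cnoise_eq power2_eq_square algebra_simps)
  then show ?thesis
    using cavg_pull[of "cavg i g" i "cavg i g" x] cavg_pull[of "cavg i g" i "\<lambda>_. 1" x]
    by (simp add: cavg_add cavg_cmult cavg_pull cavg_upd cavg_claplace cavg_const power2_eq_square)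
qed

lemma cavg_square:
  "cavg i (\<lambda>y. (g y)\<^sup>2) x = (cavg i g x)\<^sup>2 + cavg i (\<lambda>y. (claplace i g y)\<^sup>2) x"
  using cavg_cnoise_square[of i 1 g x] by (simp add: cnoise_def[abs_def])

lemma cavg_nonneg: "(\<And>y. 0 \<le> g y) \<Longrightarrow> 0 \<le> cavg i g x"
  using cavg_mono[of "\<lambda>_. 0" g i x] by (simp add: cavg_const)

lemma square_cavg_le: "(cavg i g x)\<^sup>2 \<le> cavg i (\<lambda>y. (g y)\<^sup>2) x"
  using cavg_nonneg[of "\<lambda>y. (claplace i g y)\<^sup>2" i x] cavg_square[of i g x] by simp

text \<open>The finite Cauchy-Schwarz inequality after giving each factor the square root of the
  weight.\<close>

lemma avg_Cauchy_Schwarz: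
  "(avg S (\<lambda>y. g y * h y) x)\<^sup>2 \<le> avg S (\<lambda>y. (g y)\<^sup>2) x * avg S (\<lambda>y. (h y)\<^sup>2) x"
proof -
  let ?w = "\<lambda>y. sqrt (\<Prod>j\<in>S. mu (y j))"
  have w: "?w y * ?w y = (\<Prod>j\<in>S. mu (y j))" for y
    by (simp add: prod_nonneg mu_nonneg)
  have "(\<Sum>y\<in>pts S. (?w y * g (merge S y x)) * (?w y * h (merge S y x)))\<^sup>2
      \<le> (\<Sum>y\<in>pts S. (?w y * g (merge S y x))\<^sup>2) * (\<Sum>y\<in>pts S. (?w y * h (merge S y x))\<^sup>2)"
    by (rule Cauchy_Schwarz_ineq_sum)
  moreover have "(?w y * a) * (?w y * b) = (\<Prod>j\<in>S. mu (y j)) * (a * b)" for y a b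
    using w[of y] by (metis mult.assoc mult.left_commute)
  moreover have "(?w y * a)\<^sup>2 = (\<Prod>j\<in>S. mu (y j)) * a\<^sup>2" for y a
    using w[of y] by (simp add: power2_eq_square)
  ultimately show ?thesis by (simp add: avg_def expect_def)
qed

section \<open>Factorisation of the noise operator over coordinates\<close>

lemma noise_on_empty [simp]: "noise_on s {} g = g"
  by (simp add: noise_on_def fun_eq_iff)

lemma cavg_noise_on_sum:
  "cavg i (noise_on s B g) x
    = (\<Sum>K\<in>Pow B. s ^ card K * (1 - s) ^ (card B - card K) * cavg i (avg (B - K) g) x)"
  unfolding cavg_def noise_on_def sum_distrib_left
  by (subst sum.swap) (simp add: mult.left_commute)

text \<open>Split the kept sets by whether they contain \<open>i\<close>: those that do contribute a
  factor \<open>s\<close>, the others a factor \<open>1 - s\<close> and one more average over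
  \<open>i\<close>. Thus noise can be peeled off coordinate by coordinate.\<close>

lemma noise_on_insert:
  assumes B: "finite B" "i \<notin> B"
  shows "noise_on s (insert i B) g = cnoise s i (noise_on s B g)"
proof
  fix x
  let ?c = "\<lambda>K. s ^ card K * (1 - s) ^ (card B - card K)"
  have fin: "finite K" "card K \<le> card B" "i \<notin> K" if "K \<in> Pow B" for K
    using that B by (auto simp: finite_subset card_mono)
  have inj: "inj_on (insert i) (Pow B)"
    using B by (intro inj_onI) (metis PowD insert_ident subsetD)
  have disj: "Pow B \<inter> insert i ` Pow B = {}" using B by auto
  have "noise_on s (insert i B) g x =
      (\<Sum>K\<in>Pow B. s ^ card K * (1 - s) ^ (card (insert i B) - card K) * avg (insert i B - K) g x)
    + (\<Sum>K\<in>Pow B. s ^ card (insert i K) * (1 - s) ^ (card (insert i B) - card (insert i K))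
        * avg (insert i B - insert i K) g x)"
    unfolding noise_on_def Pow_insert
    using B disj by (simp add: sum.union_disjoint sum.reindex[OF inj])
  also have "\<dots> = (\<Sum>K\<in>Pow B. (1 - s) * (?c K * cavg i (avg (B - K) g) x))
      + (\<Sum>K\<in>Pow B. s * (?c K * avg (B - K) g x))"
  proof (intro arg_cong2[where f = "(+)"] sum.cong refl)
    fix K assume K: "K \<in> Pow B"
    have "insert i B - K = insert i (B - K)" "insert i B - insert i K = B - K"
      using fin[OF K] B by auto
    then show "s ^ card K * (1 - s) ^ (card (insert i B) - card K) * avg (insert i B - K) g x
        = (1 - s) * (?c K * cavg i (avg (B - K) g) x)"
      and "s ^ card (insert i K) * (1 - s) ^ (card (insert i B) - card (insert i K))
        * avg (insert i B - insert i K) g x = s * (?c K * avg (B - K) g x)"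
      using fin[OF K] B by (simp_all add: avg_insert' Suc_diff_le)
  qed
  also have "\<dots> = (1 - s) * (\<Sum>K\<in>Pow B. ?c K * cavg i (avg (B - K) g) x) + s * noise_on s B g x"
    by (simp add: noise_on_def sum_distrib_left)
  also have "(\<Sum>K\<in>Pow B. ?c K * cavg i (avg (B - K) g) x) = cavg i (noise_on s B g) x"
    by (simp add: cavg_noise_on_sum)
  finally show "noise_on s (insert i B) g x = cnoise s i (noise_on s B g) x"
    by (simp add: cnoise_def)
qed

lemma noise_on_lincomb:
  "noise_on s B (\<lambda>y. a * g y + b * h y) x = a * noise_on s B g x + b * noise_on s B h x"
  by (simp add: noise_on_def avg_add avg_cmult algebra_simps sum.distrib sum_distrib_left)

lemma noise_on_cavg: "i \<notin> B \<Longrightarrow> noise_on s B (cavg i g) x = cavg i (noise_on s B g) x"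
  unfolding cavg_noise_on_sum
  unfolding noise_on_def by (intro sum.cong refl) (simp add: cavg_avg)

text \<open>With its analogue for the Laplacian, this moves the operator in direction
  \<open>i\<close> onto the function itself, where an induction hypothesis about noise on
  \<open>B\<close> applies.\<close>

lemma noise_on_cnoise:
  assumes "i \<notin> B"
  shows "noise_on s B (cnoise c i g) = cnoise c i (noise_on s B g)"
  using noise_on_lincomb[of s B c g "1 - c" "cavg i g"]
  by (simp add: fun_eq_iff cnoise_def[abs_def] noise_on_cavg[OF assms])

lemma noise_on_claplace:
  assumes "i \<notin> B"
  shows "noise_on s B (claplace i g) = claplace i (noise_on s B g)"
  using noise_on_lincomb[of s B 1 g "- 1" "cavg i g"]
  by (simp add: fun_eq_iff claplace_def[abs_def] noise_on_cavg[OF assms])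

section \<open>The one-coordinate step and the induction over coordinates\<close>

text \<open>The Hilbert space is L^2 in the coordinates of \<open>A\<close>, the others being fixed
  by \<open>x\<close>. As \<open>x i\<close> varies, \<open>cavg i h\<close> plays the constant
  vector \<open>a\<close> and \<open>claplace i h\<close> the mean-zero vector Z.\<close>

lemma cavg_powr_cnoise_le:
  fixes q r rho :: real
  assumes q: "q \<ge> 2" and r: "r \<ge> 1" and rho: "0 < rho" "rho \<le> ln q / (32 * r * q)"
    and A: "finite A" "i \<notin> A"
  shows "cavg i (\<lambda>x. avg A (\<lambda>y. (cnoise rho i h y)\<^sup>2) x powr (q / 2)) x
    \<le> avg (insert i A) (\<lambda>y. (cnoise (sqrt (3 / 4)) i h y)\<^sup>2) x powr (q / 2)
      + (1 / (2 * r)) powr q * cavg i (\<lambda>x. avg A (\<lambda>y. (claplace i h y)\<^sup>2) x powr (q / 2)) x"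
proof -
  define \<alpha> where "\<alpha> = avg A (\<lambda>y. (cavg i h y)\<^sup>2) x"
  define u where "u = avg A (\<lambda>y. cavg i h y * claplace i h y)"
  define z where "z = avg A (\<lambda>y. (claplace i h y)\<^sup>2)"
  let ?C = "q / 2 * \<alpha> powr (q / 2 - 1)"
  have \<alpha>0: "\<alpha> \<ge> 0" unfolding \<alpha>_def by (rule avg_nonneg) simp
  have z0: "z y \<ge> 0" for y unfolding z_def by (rule avg_nonneg) simp
  have merge_upd: "merge A y (x(i := w)) = (merge A y x)(i := w)" for y w x
    using A by (auto simp: merge_def fun_eq_iff)
  have \<alpha>w: "avg A (\<lambda>y. (cavg i h y)\<^sup>2) (x(i := w)) = \<alpha>" for w
    by (simp add: \<alpha>_def avg_def merge_upd cavg_upd)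
  have expand: "(cnoise s i h y)\<^sup>2 = (cavg i h y)\<^sup>2 + (2 * s * (cavg i h y * claplace i h y) + s\<^sup>2 * (claplace i h y)\<^sup>2)" for s y
    by (simp add: cnoise_eq power2_eq_square algebra_simps)
  have noisew: "avg A (\<lambda>y. (cnoise s i h y)\<^sup>2) (x(i := w))
      = \<alpha> + 2 * s * u (x(i := w)) + s\<^sup>2 * z (x(i := w))" for s w
    by (simp add: expand avg_add avg_cmult \<alpha>w u_def z_def)
  have uz: "(u (x(i := w)))\<^sup>2 \<le> \<alpha> * z (x(i := w))" for w
    using avg_Cauchy_Schwarz[of A "cavg i h" "claplace i h" "x(i := w)"]
    by (simp add: \<alpha>w u_def z_def)
  have "cavg i u x = avg A (cavg i (\<lambda>y. cavg i h y * claplace i h y)) x"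
    unfolding u_def using A by (simp add: cavg_avg)
  also have "cavg i (\<lambda>y. cavg i h y * claplace i h y) = (\<lambda>y. 0)"
    by (simp add: fun_eq_iff cavg_pull cavg_upd cavg_claplace)
  \<comment> \<open>This removes the linear term of the scalar bound after averaging over coordinate
    \<open>i\<close>.\<close>
  finally have u0: "cavg i u x = 0" by (simp add: avg_def expect_def)
  have "cavg i (\<lambda>x. avg A (\<lambda>y. (cnoise rho i h y)\<^sup>2) x powr (q / 2)) x
      \<le> cavg i (\<lambda>x. \<alpha> powr (q / 2) + q * rho * \<alpha> powr (q / 2 - 1) * u x
        + ?C * (3 / 4 * z x) + (1 / (2 * r)) powr q * z x powr (q / 2)) x"
    unfolding cavg_def noisew
    by (intro sum_mono mult_left_mono powr_sum_bound q r rho \<alpha>0 z0 uz mu_nonneg)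
  also have "\<dots> = (\<alpha> powr (q / 2) + ?C * (3 / 4 * cavg i z x))
      + (1 / (2 * r)) powr q * cavg i (\<lambda>x. z x powr (q / 2)) x"
    by (simp only: cavg_add cavg_cmult cavg_const u0)
  \<comment> \<open>Convexity turns the first two terms back into a power; by Pythagoras its base is
    the second moment with noise \<open>sqrt (3 / 4)\<close>.\<close>
  also have "\<alpha> powr (q / 2) + ?C * (3 / 4 * cavg i z x) \<le> (\<alpha> + 3 / 4 * cavg i z x) powr (q / 2)"
    using powr_add_ge[of "q / 2" \<alpha> "3 / 4 * cavg i z x"] q \<alpha>0 cavg_nonneg[of z i x, OF z0] by simp
  also have "\<alpha> + 3 / 4 * cavg i z x = avg (insert i A) (\<lambda>y. (cnoise (sqrt (3 / 4)) i h y)\<^sup>2) x"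
  proof -
    have "cavg i z x = avg A (cavg i (\<lambda>y. (claplace i h y)\<^sup>2)) x"
      unfolding z_def using A by (simp add: cavg_avg)
    moreover have "avg (insert i A) (\<lambda>y. (cnoise (sqrt (3 / 4)) i h y)\<^sup>2) x
        = avg A (\<lambda>y. (cavg i h y)\<^sup>2 + 3 / 4 * cavg i (\<lambda>y. (claplace i h y)\<^sup>2) y) x"
      using A by (simp add: avg_insert cavg_cnoise_square[abs_def])
    ultimately show ?thesis by (simp only: avg_add avg_cmult \<alpha>_def)
  qed
  finally show ?thesis by (simp add: z_def)
qed

text \<open>\<open>B\<close> holds the coordinates still measured in L^q, \<open>A\<close> those
  already moved to L^2; all others are frozen at \<open>x\<close>. The bound is linear in the second
  moment of \<open>f\<close>, with only \<open>M\<close> raised to \<open>q - 2\<close>, so that the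
  two branches of the induction can be added.\<close>

lemma avg_powr_noise_on_le:
  fixes q r rho M :: real
  assumes q: "q \<ge> 2" and r: "r \<ge> 1" and rho: "0 < rho" "rho \<le> ln q / (32 * r * q)"
    and "finite B" "finite A" "A \<inter> B = {}" "M \<ge> 0"
    and "\<And>U x. U \<subseteq> B \<Longrightarrow> avg (A \<union> (B - U)) (\<lambda>y. (f y)\<^sup>2) x \<le> (r ^ card U * M)\<^sup>2"
  shows "avg B (\<lambda>x. avg A (\<lambda>y. (noise_on rho B f y)\<^sup>2) x powr (q / 2)) x
    \<le> M powr (q - 2) * avg (A \<union> B) (\<lambda>y. (f y)\<^sup>2) x"
  using assms(5-)
proof (induction B arbitrary: A f M x rule: finite_induct)
  case empty
  define v where "v = avg A (\<lambda>y. (f y)\<^sup>2) x"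
  have v: "0 \<le> v" unfolding v_def by (rule avg_nonneg) simp
  have "v \<le> M\<^sup>2" using empty.prems(4)[of "{}" x] by (simp add: v_def)
  \<comment> \<open>Without coordinates left, one factor \<open>v\<close> is kept and the rest is
    bounded by the hypothesis at \<open>U = {}\<close>.\<close>
  have "v powr (q / 2) = v powr (q / 2 - 1) * v"
    using v by (cases "v = 0") (simp_all add: powr_diff)
  also have "\<dots> \<le> (M\<^sup>2) powr (q / 2 - 1) * v"
    using q v \<open>v \<le> M\<^sup>2\<close> by (intro mult_right_mono powr_mono2) auto
  also have "(M\<^sup>2) powr (q / 2 - 1) = M powr (q - 2)"
  proof (cases "M = 0")
    case False
    then show ?thesis using \<open>M \<ge> 0\<close> by (simp add: powr_powr algebra_simps flip: powr_numeral)
  qed simp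
  finally show ?case by (simp add: v_def)
next
  case (insert i B)
  let ?c = "sqrt (3 / 4)"
  let ?g = "cnoise ?c i f" and ?l = "claplace i f"
  note B = \<open>finite B\<close> \<open>i \<notin> B\<close>
  have A: "finite A" "i \<notin> A" "A \<inter> B = {}" using insert.prems by auto
  note glob = insert.prems(4)
  have swap: "avg S (cavg i h) x = avg (insert i S) h x" if "S \<subseteq> A \<union> B" for S h x
  proof -
    have "finite S" "i \<notin> S" using that A B by (auto intro: finite_subset)
    then show ?thesis by (simp add: avg_insert)
  qed
  have glob1: "avg (insert i (A \<union> (B - U))) (\<lambda>y. (f y)\<^sup>2) x \<le> (r ^ card U * M)\<^sup>2"
    if "U \<subseteq> B" for U x
  proof -
    have "insert i (A \<union> (B - U)) = A \<union> (insert i B - U)" using that B by auto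
    then show ?thesis using glob[of U x] that by auto
  qed
  have glob2: "avg (A \<union> (B - U)) (\<lambda>y. (f y)\<^sup>2) x \<le> (r ^ Suc (card U) * M)\<^sup>2"
    if "U \<subseteq> B" for U x
  proof -
    have "A \<union> (B - U) = A \<union> (insert i B - insert i U)" using B by auto
    moreover have "card (insert i U) = Suc (card U)"
      using that B finite_subset[OF that] by (subst card_insert_disjoint) auto
    ultimately show ?thesis using glob[of "insert i U" x] that by auto
  qed
  have g_le: "cavg i (\<lambda>y. (?g y)\<^sup>2) x \<le> cavg i (\<lambda>y. (f y)\<^sup>2) x" for x
    using cavg_nonneg[of "\<lambda>y. (?l y)\<^sup>2" i x] by (simp add: cavg_cnoise_square cavg_square[of i f])
  \<comment> \<open>First branch: \<open>i\<close> joins \<open>A\<close>. Noise contracts L^2 in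
    direction \<open>i\<close>, so the same \<open>M\<close> serves.\<close>
  have IHg: "avg B (\<lambda>x. avg (insert i A) (\<lambda>y. (noise_on rho B ?g y)\<^sup>2) x powr (q / 2)) x
      \<le> M powr (q - 2) * avg (insert i A \<union> B) (\<lambda>y. (?g y)\<^sup>2) x"
  proof (rule insert.IH)
    fix U x assume U: "U \<subseteq> B"
    then have U': "A \<union> (B - U) \<subseteq> A \<union> B" by auto
    have "avg (insert i A \<union> (B - U)) (\<lambda>y. (?g y)\<^sup>2) x = avg (A \<union> (B - U)) (cavg i (\<lambda>y. (?g y)\<^sup>2)) x"
      by (simp add: swap[OF U'])
    also have "\<dots> \<le> avg (A \<union> (B - U)) (cavg i (\<lambda>y. (f y)\<^sup>2)) x" by (rule avg_mono[OF g_le])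
    also have "\<dots> \<le> (r ^ card U * M)\<^sup>2" using glob1[OF U] by (simp add: swap[OF U'])
    finally show "avg (insert i A \<union> (B - U)) (\<lambda>y. (?g y)\<^sup>2) x \<le> (r ^ card U * M)\<^sup>2" .
  qed (use A B insert.prems in auto)
  \<comment> \<open>Second branch: \<open>i\<close> is in neither set. The bound is needed for every
    \<open>x\<close>, since \<open>x i\<close> is averaged afterwards.\<close>
  have IHl: "avg B (\<lambda>x. avg A (\<lambda>y. (noise_on rho B ?l y)\<^sup>2) x powr (q / 2)) x
      \<le> (2 * r * M) powr (q - 2) * avg (A \<union> B) (\<lambda>y. (?l y)\<^sup>2) x" for x
  proof (rule insert.IH)
    fix U x assume U: "U \<subseteq> B"
    then have U': "A \<union> (B - U) \<subseteq> A \<union> B" by auto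
    have "(?l y)\<^sup>2 \<le> 2 * (f y)\<^sup>2 + 2 * cavg i (\<lambda>y. (f y)\<^sup>2) y" for y
    proof -
      have "(?l y)\<^sup>2 \<le> 2 * (f y)\<^sup>2 + 2 * (cavg i f y)\<^sup>2"
        using zero_le_power2[of "f y + cavg i f y"]
        by (simp add: claplace_def power2_eq_square algebra_simps)
      then show ?thesis using square_cavg_le[of i f y] by simp
    qed
    then have "avg (A \<union> (B - U)) (\<lambda>y. (?l y)\<^sup>2) x
        \<le> avg (A \<union> (B - U)) (\<lambda>y. 2 * (f y)\<^sup>2 + 2 * cavg i (\<lambda>y. (f y)\<^sup>2) y) x"
      by (rule avg_mono)
    \<comment> \<open>In the first summand \<open>i\<close> is frozen, which costs one more factor
      \<open>r\<close>; in the second it is averaged. Together they give the factor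
      \<open>2 * r\<close> on \<open>M\<close>.\<close>
    also have "\<dots> \<le> 2 * (r ^ Suc (card U) * M)\<^sup>2 + 2 * (r ^ card U * M)\<^sup>2"
      using glob1[OF U, of x] glob2[OF U, of x] by (simp add: avg_add avg_cmult swap[OF U'])
    also have "\<dots> = (2 * r\<^sup>2 + 2) * (r ^ card U * M)\<^sup>2" by (simp add: power2_eq_square algebra_simps)
    also have "\<dots> \<le> (4 * r\<^sup>2) * (r ^ card U * M)\<^sup>2"
      using power_mono[OF r, of 2] by (intro mult_right_mono) auto
    also have "\<dots> = (r ^ card U * (2 * r * M))\<^sup>2" by (simp add: power2_eq_square algebra_simps)
    finally show "avg (A \<union> (B - U)) (\<lambda>y. (?l y)\<^sup>2) x \<le> (r ^ card U * (2 * r * M))\<^sup>2" .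
  qed (use A B r insert.prems in auto)
  \<comment> \<open>\<open>V\<close> and \<open>W\<close> are the energies of the mean and mean-zero
    parts in direction \<open>i\<close>: \<open>f\<close> has \<open>V + W\<close>, its damped
    version \<open>V + 3/4 W\<close>, and the Laplacian branch must supply at most the missing
    \<open>W / 4\<close>.\<close>
  define V where "V = avg (A \<union> B) (\<lambda>y. (cavg i f y)\<^sup>2) x"
  define W where "W = avg (A \<union> B) (cavg i (\<lambda>y. (?l y)\<^sup>2)) x"
  have W: "W \<ge> 0" unfolding W_def by (intro avg_nonneg cavg_nonneg) simp
  have avg_g: "avg (insert i A \<union> B) (\<lambda>y. (?g y)\<^sup>2) x = V + 3 / 4 * W"
    using swap[of "A \<union> B" "\<lambda>y. (?g y)\<^sup>2" x]
    by (simp add: cavg_cnoise_square[abs_def] V_def W_def avg_add avg_cmult del: times_divide_eq_left)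
  have avg_f: "avg (A \<union> insert i B) (\<lambda>y. (f y)\<^sup>2) x = V + W"
    using swap[of "A \<union> B" "\<lambda>y. (f y)\<^sup>2" x]
    by (simp add: cavg_square[of i f, abs_def] V_def W_def avg_add)
  have coeff: "(1 / (2 * r)) powr q * (2 * r * M) powr (q - 2) \<le> 1 / 4 * M powr (q - 2)"
  proof -
    have "(1 / (2 * r)) powr q * (2 * r) powr (q - 2) = 1 / (2 * r)\<^sup>2"
      using r by (simp add: powr_divide powr_diff)
    also have "\<dots> \<le> 1 / 4" using power_mono[OF r, of 2] r by (simp add: field_simps power2_eq_square)
    finally have "(1 / (2 * r)) powr q * (2 * r) powr (q - 2) * M powr (q - 2) \<le> 1 / 4 * M powr (q - 2)"
      by (rule mult_right_mono) simp
    then show ?thesis using r insert.prems(3) by (simp add: powr_mult mult.assoc)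
  qed
  have "avg (insert i B) (\<lambda>x. avg A (\<lambda>y. (noise_on rho (insert i B) f y)\<^sup>2) x powr (q / 2)) x
      = avg B (cavg i (\<lambda>x. avg A (\<lambda>y. (cnoise rho i (noise_on rho B f) y)\<^sup>2) x powr (q / 2))) x"
    using B by (simp add: avg_insert noise_on_insert)
  also have "\<dots> \<le> avg B (\<lambda>x. avg (insert i A) (\<lambda>y. (cnoise ?c i (noise_on rho B f) y)\<^sup>2) x powr (q / 2)
      + (1 / (2 * r)) powr q * cavg i (\<lambda>x. avg A (\<lambda>y. (claplace i (noise_on rho B f) y)\<^sup>2) x powr (q / 2)) x) x"
    by (intro avg_mono cavg_powr_cnoise_le q r rho A)
  also have "\<dots> = avg B (\<lambda>x. avg (insert i A) (\<lambda>y. (noise_on rho B ?g y)\<^sup>2) x powr (q / 2)) x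
      + (1 / (2 * r)) powr q * cavg i (avg B (\<lambda>x. avg A (\<lambda>y. (noise_on rho B ?l y)\<^sup>2) x powr (q / 2))) x"
    using B by (simp add: avg_add avg_cmult noise_on_cnoise noise_on_claplace cavg_avg)
  also have "\<dots> \<le> M powr (q - 2) * (V + 3 / 4 * W)
      + (1 / (2 * r)) powr q * ((2 * r * M) powr (q - 2) * W)"
  proof (intro add_mono mult_left_mono)
    show "avg B (\<lambda>x. avg (insert i A) (\<lambda>y. (noise_on rho B ?g y)\<^sup>2) x powr (q / 2)) x
        \<le> M powr (q - 2) * (V + 3 / 4 * W)"
      using IHg avg_g by simp
    have "cavg i (avg B (\<lambda>x. avg A (\<lambda>y. (noise_on rho B ?l y)\<^sup>2) x powr (q / 2))) x
        \<le> cavg i (\<lambda>x. (2 * r * M) powr (q - 2) * avg (A \<union> B) (\<lambda>y. (?l y)\<^sup>2) x) x"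
      by (rule cavg_mono[OF IHl])
    also have "\<dots> = (2 * r * M) powr (q - 2) * W"
      using A B by (simp add: cavg_cmult cavg_avg W_def)
    finally show "cavg i (avg B (\<lambda>x. avg A (\<lambda>y. (noise_on rho B ?l y)\<^sup>2) x powr (q / 2))) x
        \<le> (2 * r * M) powr (q - 2) * W" .
  qed simp
  also have "\<dots> \<le> M powr (q - 2) * (V + 3 / 4 * W) + 1 / 4 * M powr (q - 2) * W"
    using mult_right_mono[OF coeff W] by (simp add: mult.assoc)
  also have "\<dots> = M powr (q - 2) * avg (A \<union> insert i B) (\<lambda>y. (f y)\<^sup>2) x"
    unfolding avg_f by (simp add: algebra_simps)
  finally show ?case .
qed

end

section \<open>Transfer to the norms and noise operator of the statement\<close>

theorem mainTheorem1:
  fixes mu :: "'a::finite \<Rightarrow> real" and n :: nat and q r rho :: real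
    and f :: "(nat \<Rightarrow> 'a) \<Rightarrow> real"
  assumes "fin_prob mu"
    and "q \<ge> 2" and "r \<ge> 1"
    and "\<forall>S \<subseteq> {..<n}. \<forall>x \<in> pts S.
           lnorm mu ({..<n} - S) 2 (restr S f x) \<le> r ^ card S * lnorm mu {..<n} 2 f"
    and "0 < rho" and "rho \<le> ln q / (32 * r * q)"
  shows "lnorm mu {..<n} q (noise mu n rho f) \<le> lnorm mu {..<n} 2 f"
proof -
  interpret finite_probability mu by standard (rule assms)
  define M where "M = lnorm mu {..<n} 2 f"
  \<comment> \<open>The induction evaluates functions at arbitrary points, whereas the hypotheses
    control \<open>f\<close> only at extensional ones; \<open>g\<close> ignores all coordinates
    beyond the first \<open>n\<close>.\<close>
  define g where "g = (\<lambda>x. f (restrict x {..<n}))"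
  have expect_sq: "0 \<le> expect mu S (\<lambda>x. (h x)\<^sup>2)" for S and h :: "(nat \<Rightarrow> 'a) \<Rightarrow> real"
    unfolding expect_def by (intro sum_nonneg mult_nonneg_nonneg prod_nonneg) (auto simp: mu_nonneg)
  have lnorm_sq: "(lnorm mu S 2 h)\<^sup>2 = expect mu S (\<lambda>x. (h x)\<^sup>2)" for S and h :: "(nat \<Rightarrow> 'a) \<Rightarrow> real"
    using expect_sq[of S h] by (simp add: lnorm_def powr_half_sqrt)
  have M: "M \<ge> 0" by (simp add: M_def lnorm_def)
  have avg_g: "avg ({..<n} - U) (\<lambda>y. (g y)\<^sup>2) x = (lnorm mu ({..<n} - U) 2 (restr U f (restrict x U)))\<^sup>2"
    if "U \<subseteq> {..<n}" for U x
  proof -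
    have "restrict (merge ({..<n} - U) y x) {..<n} = merge U (restrict x U) y"
      if "y \<in> pts ({..<n} - U)" for y
      using that \<open>U \<subseteq> {..<n}\<close>
      by (auto simp: merge_def restrict_def fun_eq_iff pts_def PiE_def extensional_def)
    then show ?thesis
      unfolding lnorm_sq by (simp add: avg_def expect_def g_def restr_def)
  qed
  \<comment> \<open>Extensional points are \<open>undefined\<close> off \<open>{..<n}\<close>, so
    merging them with this base point changes nothing.\<close>
  have avg_full: "avg {..<n} h (\<lambda>_. undefined) = expect mu {..<n} h" for h
  proof -
    have "merge {..<n} y (\<lambda>_. undefined) = y" if "y \<in> pts {..<n}" for y :: "nat \<Rightarrow> 'a"
      using that by (auto simp: merge_def fun_eq_iff pts_def PiE_def extensional_def)
    then show ?thesis by (simp add: avg_def expect_def)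
  qed
  have noise_eq: "noise_on rho {..<n} g x = noise mu n rho f x" if x: "x \<in> pts {..<n}" for x
  proof -
    have "avg ({..<n} - K) g x = expect mu ({..<n} - K) (\<lambda>y. f (merge K x y))" if "K \<subseteq> {..<n}" for K
    proof -
      have "restrict (merge ({..<n} - K) y x) {..<n} = merge K x y" if "y \<in> pts ({..<n} - K)" for y
        using that x \<open>K \<subseteq> {..<n}\<close>
        by (auto simp: merge_def restrict_def fun_eq_iff pts_def PiE_def extensional_def)
      then show ?thesis by (simp add: avg_def expect_def g_def)
    qed
    then show ?thesis by (simp add: noise_on_def noise_def)
  qed
  have abs_powr: "\<bar>a\<bar> powr q = (a\<^sup>2) powr (q / 2)" for a :: real
    using powr_powr[of "\<bar>a\<bar>" 2 "q / 2"] by simp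
  have "expect mu {..<n} (\<lambda>x. \<bar>noise mu n rho f x\<bar> powr q)
      = expect mu {..<n} (\<lambda>x. ((noise_on rho {..<n} g x)\<^sup>2) powr (q / 2))"
    by (simp add: expect_def noise_eq abs_powr)
  also have "\<dots> = avg {..<n} (\<lambda>x. avg {} (\<lambda>y. (noise_on rho {..<n} g y)\<^sup>2) x powr (q / 2)) (\<lambda>_. undefined)"
    by (simp add: avg_full)
  also have "\<dots> \<le> M powr (q - 2) * avg ({} \<union> {..<n}) (\<lambda>y. (g y)\<^sup>2) (\<lambda>_. undefined)"
  \<comment> \<open>The induction starts with every coordinate in \<open>B\<close> and
    \<open>A\<close> empty; freezing \<open>U\<close> is then exactly the globalness hypothesis at
    \<open>restrict x U\<close>.\<close>
  proof (rule avg_powr_noise_on_le[OF assms(2,3,5,6)])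
    fix U and x :: "nat \<Rightarrow> 'a" assume U: "U \<subseteq> {..<n}"
    have "restrict x U \<in> pts U" by (simp add: pts_def)
    then have "lnorm mu ({..<n} - U) 2 (restr U f (restrict x U)) \<le> r ^ card U * M"
      using assms(4) U by (simp add: M_def)
    then show "avg ({} \<union> ({..<n} - U)) (\<lambda>y. (g y)\<^sup>2) x \<le> (r ^ card U * M)\<^sup>2"
      using avg_g[OF U, of x] by (simp add: power_mono lnorm_def)
  qed (use M in auto)
  also have "avg ({} \<union> {..<n}) (\<lambda>y. (g y)\<^sup>2) (\<lambda>_. undefined) = M\<^sup>2"
    using avg_g[of "{}" "\<lambda>_. undefined"] by (simp add: M_def restr_def merge_def)
  also have "M powr (q - 2) * M\<^sup>2 = M powr q"
    using M by (cases "M = 0") (simp_all add: powr_diff)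
  finally have "lnorm mu {..<n} q (noise mu n rho f) \<le> (M powr q) powr (1 / q)"
    unfolding lnorm_def using assms(2)
    by (intro powr_mono2) (auto simp: expect_def intro!: sum_nonneg mult_nonneg_nonneg prod_nonneg mu_nonneg)
  also have "\<dots> = M" using M assms(2) by (simp add: powr_powr)
  finally show ?thesis by (simp add: M_def)
qed

end
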